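(* Consider an instance of the multiple gradual cover location problem (MGCLP) with finite set of potential facility locations $I$, finite set of customers $J$, coverages $f_{ij}\in[0,1]$ ($i\in I$, $j\in J$), customer weights $w_j\ge 0$, parameter $\theta\in[0,1]$, and a positive integer $K$. Let $i,i'\in I$ be two distinct facility locations with $f_{ij}\ge f_{i'j}$ for each $j\in J$. Then there is an optimal solution of the MGCLP satisfying the ordering constraint in which no facility is opened at location $i'$.
   Context: Let $I$ be a finite nonempty set of potential facility locations, $J$ a finite set of customers, $f_{ij}\in[0,1]$ the coverage customer $j\in J$ receives from a facility at location $i\in I$, $w_j\ge 0$ the weight of customer $j$, $\theta\in[0,1]$, and $K$ a positive integer. Co-location (opening several facilities at one location) is allowed: let $I^K=I\times\{1,\dots,K\}$, whose element $(i,k)$, also written $i^k$, is the $k$-th facility (copy) at location $i$; every copy $i^k$ has the same coverages $f_{ij}$ as location $i$. For $I'\subseteq I^K$ and $j\in J$, the joint coverage function is $$p_j(\theta,I')=\theta\Big(\max_{(i,k)\in I'} f_{ij}\Big)+(1-\theta)\Big(1-\prod_{(i,k)\in I'}(1-f_{ij})\Big),$$ with the maximum over the empty set taken to be $0$ and the empty product taken to be $1$. The objective function is $W(\theta,I')=\sum_{j\in J}w_j\,p_j(\theta,I')$. The MGCLP is the problem of maximizing $W(\theta,I')$ over all $I'\subseteq I^K$ with $|I'|\le K$. A (feasible) solution is such a set $I'$; its elements are the opened facilities; it is optimal if it attains the maximum. No facility is opened at location $i'$ if $(i',k)\notin I'$ for all $1\le k\le K$. Ordering constraint (symmetry breaking,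 assumed throughout): for every location $i$ and $1\le k\le K-1$, if $(i,k+1)\in I'$ then $(i,k)\in I'$. This does not change the optimal value. *)

theory Defs
  imports Complex_Main
begin

text \<open>A facility is a pair \<open>(i, k)\<close>: the \<open>k\<close>-th copy at location \<open>i\<close>, with copies numbered from 1.\<close>

definition facilities :: "'i set \<Rightarrow> nat \<Rightarrow> ('i \<times> nat) set" where
  "facilities I K = I \<times> {1..K}"

text \<open>The conditional fixes the maximum over the empty set to be 0, since \<open>Max {}\<close> is unspecified.\<close>

definition max_coverage :: "('i \<Rightarrow> 'j \<Rightarrow> real) \<Rightarrow> 'j \<Rightarrow> ('i \<times> nat) set \<Rightarrow> real" where
  "max_coverage f j S = (if S = {} then 0 else Max ((\<lambda>(i, k). f i j) ` S))"

definition joint_coverage ::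
    "('i \<Rightarrow> 'j \<Rightarrow> real) \<Rightarrow> 'j \<Rightarrow> real \<Rightarrow> ('i \<times> nat) set \<Rightarrow> real" where
  "joint_coverage f j \<theta> S =
     \<theta> * max_coverage f j S + (1 - \<theta>) * (1 - (\<Prod>(i, k)\<in>S. 1 - f i j))"

definition objective ::
    "'j set \<Rightarrow> ('i \<Rightarrow> 'j \<Rightarrow> real) \<Rightarrow> ('j \<Rightarrow> real) \<Rightarrow> real \<Rightarrow> ('i \<times> nat) set \<Rightarrow> real" where
  "objective J f w \<theta> S = (\<Sum>j\<in>J. w j * joint_coverage f j \<theta> S)"

definition feasible :: "'i set \<Rightarrow> nat \<Rightarrow> ('i \<times> nat) set \<Rightarrow> bool" where
  "feasible I K S \<longleftrightarrow> S \<subseteq> facilities I K \<and> card S \<le> K"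

text \<open>Optimality is with respect to all feasible solutions, not only the ordered ones.\<close>

definition optimal ::
    "'i set \<Rightarrow> 'j set \<Rightarrow> ('i \<Rightarrow> 'j \<Rightarrow> real) \<Rightarrow> ('j \<Rightarrow> real) \<Rightarrow> real \<Rightarrow> nat
      \<Rightarrow> ('i \<times> nat) set \<Rightarrow> bool" where
  "optimal I J f w \<theta> K S \<longleftrightarrow>
     feasible I K S \<and> (\<forall>T. feasible I K T \<longrightarrow> objective J f w \<theta> T \<le> objective J f w \<theta> S)"

definition ordered :: "'i set \<Rightarrow> nat \<Rightarrow> ('i \<times> nat) set \<Rightarrow> bool" where
  "ordered I K S \<longleftrightarrow> (\<forall>i\<in>I. \<forall>k\<in>{1..<K}. (i, k + 1) \<in> S \<longrightarrow> (i, k) \<in> S)"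

definition unopened :: "nat \<Rightarrow> 'i \<Rightarrow> ('i \<times> nat) set \<Rightarrow> bool" where
  "unopened K i S \<longleftrightarrow> (\<forall>k\<in>{1..K}. (i, k) \<notin> S)"

end

theory Submission
  imports Defs
begin

text \<open>Only the number of facilities opened at each location matters for the objective, and opening
  a facility at a location with larger coverages instead can only increase it: the maximum of the
  coverages increases, and each factor \<open>1 - f i j\<close> of the product shrinks while staying
  nonnegative. Moving all facilities from \<open>i'\<close> to \<open>i\<close> and then renumbering the copies at each
  location consecutively from 1 therefore turns an optimal solution into an ordered solution that is at
  least as good, hence again optimal, and that leaves \<open>i'\<close> unopened. There are always enough
  copies at \<open>i\<close> to receive the moved facilities, because every location offers as many copies as
  the whole solution may contain.

  Moving and renumbering are done in one step: the solution \<open>S\<close> is sent to \<open>relocate r S\<close>, where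
  \<open>r\<close> maps each location to its replacement. Lemma \<open>relocate_bij\<close> matches the two solutions
  facility by facility, which gives the cardinality bound and, through
  \<open>joint_coverage_mono\<close>, the comparison of the objective values.\<close>

text \<open>Forgetting the copy numbers of \<open>S\<close> and issuing new ones avoids collisions between facilities
  with the same copy number that \<open>r\<close> moves to a common location, and makes the result ordered.\<close>

definition relocate :: "('i \<Rightarrow> 'i) \<Rightarrow> ('i \<times> nat) set \<Rightarrow> ('i \<times> nat) set" where
  "relocate r S = {(l, k). k \<in> {1..card {x \<in> S. r (fst x) = l}}}"

text \<open>Both sides of the bijection have, over each location \<open>l\<close>, a fibre of the same finite size: the
  facilities that \<open>r\<close> sends to \<open>l\<close>, and an initial segment of the copy numbers. Enumerating each
  fibre and gluing the enumerations together gives the matching.\<close>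

lemma relocate_bij:
  assumes "finite S"
  obtains g where "bij_betw g S (relocate r S)" and "\<And>x. x \<in> S \<Longrightarrow> fst (g x) = r (fst x)"
proof -
  have "\<forall>l. \<exists>h. bij_betw h {x \<in> S. r (fst x) = l} {1..card {x \<in> S. r (fst x) = l}}"
    by (intro allI finite_same_card_bij) (use assms in auto)
  from choice[OF this] obtain h
    where h: "\<And>l. bij_betw (h l) {x \<in> S. r (fst x) = l} {1..card {x \<in> S. r (fst x) = l}}"
    by blast
  let ?g = "\<lambda>x. (r (fst x), h (r (fst x)) x)"
  have "inj_on ?g S"
  proof (rule inj_onI)
    fix x y assume "x \<in> S" "y \<in> S" "?g x = ?g y"
    then show "x = y"
      using bij_betw_imp_inj_on[OF h[of "r (fst x)"]] by (auto dest: inj_onD)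
  qed
  moreover have "?g ` S = relocate r S"
  proof (intro subset_antisym subsetI)
    fix y assume "y \<in> ?g ` S"
    then show "y \<in> relocate r S"
      using bij_betwE[OF h] by (fastforce simp: relocate_def)
  next
    fix y assume y: "y \<in> relocate r S"
    obtain l k where lk: "y = (l, k)" by (cases y)
    with y have "k \<in> h l ` {x \<in> S. r (fst x) = l}"
      using bij_betw_imp_surj_on[OF h[of l]] by (simp add: relocate_def)
    then show "y \<in> ?g ` S" using lk by auto
  qed
  ultimately show ?thesis
    by (intro that[of ?g]) (auto simp: bij_betw_def)
qed

lemma feasible_relocate:
  assumes fin: "finite I" and feas: "feasible I K S" and r: "\<And>l. l \<in> I \<Longrightarrow> r l \<in> I"
  shows "feasible I K (relocate r S)"
proof -
  have sub: "S \<subseteq> facilities I K" and K: "card S \<le> K"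
    using feas by (auto simp: feasible_def)
  have finS: "finite S"
    using sub fin by (auto simp: facilities_def intro: finite_subset)
  obtain g where g: "bij_betw g S (relocate r S)" "\<And>x. x \<in> S \<Longrightarrow> fst (g x) = r (fst x)"
    using relocate_bij[OF finS] by metis
  have "y \<in> facilities I K" if y: "y \<in> relocate r S" for y
  proof -
    obtain x where x: "x \<in> S" "y = g x"
      using bij_betw_imp_surj_on[OF g(1)] y by blast
    then have "fst y \<in> I"
      using g(2) sub r by (auto simp: facilities_def)
    \<comment> \<open>No location receives more facilities than \<open>S\<close> contains, so copies up to \<open>K\<close> suffice.\<close>
    moreover have "card {x \<in> S. r (fst x) = fst y} \<le> card S"
      by (rule card_mono[OF finS]) auto
    ultimately show ?thesis
      using y K by (auto simp: relocate_def facilities_def)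
  qed
  moreover have "card (relocate r S) \<le> K"
    using bij_betw_same_card[OF g(1)] K by simp
  ultimately show ?thesis by (auto simp: feasible_def)
qed

lemma ordered_relocate: "ordered I K (relocate r S)"
  by (auto simp: ordered_def relocate_def)

lemma unopened_relocate:
  assumes "l \<notin> range r"
  shows "unopened K l (relocate r S)"
proof -
  have "card {x \<in> S. r (fst x) = l} = 0" using assms by (auto simp: card_eq_0_iff)
  then show ?thesis unfolding unopened_def relocate_def by simp
qed

lemma max_coverage_mono:
  assumes "finite S" and g: "bij_betw g S T"
    and le: "\<And>x. x \<in> S \<Longrightarrow> f (fst x) j \<le> f (fst (g x)) j"
  shows "max_coverage f j S \<le> max_coverage f j T"
proof (cases "S = {}")
  case True
  then show ?thesis using g by (simp add: bij_betw_def)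
next
  case False
  have T: "T = g ` S" using g by (simp add: bij_betw_def)
  have "Max ((\<lambda>x. f (fst x) j) ` S) \<le> Max ((\<lambda>x. f (fst x) j) ` T)"
  proof (rule Max.boundedI)
    have "f (fst x) j \<le> Max ((\<lambda>x. f (fst x) j) ` T)" if "x \<in> S" for x
      using le[OF that] by (rule order_trans) (rule Max_ge, use assms that T in auto)
    then show "c \<le> Max ((\<lambda>x. f (fst x) j) ` T)" if "c \<in> (\<lambda>x. f (fst x) j) ` S" for c
      using that by blast
  qed (use assms False in auto)
  then show ?thesis
    using False T by (simp add: max_coverage_def case_prod_beta)
qed

text \<open>The upper bound 1 on the coverages in \<open>T\<close> keeps the factors of the product nonnegative, so
  that smaller factors give a smaller product.\<close>

lemma joint_coverage_mono:
  assumes "finite S" and g: "bij_betw g S T" and \<theta>: "\<theta> \<in> {0..1}"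
    and le: "\<And>x. x \<in> S \<Longrightarrow> f (fst x) j \<le> f (fst (g x)) j"
    and le1: "\<And>x. x \<in> S \<Longrightarrow> f (fst (g x)) j \<le> 1"
  shows "joint_coverage f j \<theta> S \<le> joint_coverage f j \<theta> T"
proof -
  have "(\<Prod>x\<in>T. 1 - f (fst x) j) = (\<Prod>x\<in>S. 1 - f (fst (g x)) j)"
    by (rule prod.reindex_bij_betw[OF g, symmetric])
  also have "\<dots> \<le> (\<Prod>x\<in>S. 1 - f (fst x) j)"
    using le le1 by (intro prod_mono) auto
  finally have "(\<Prod>x\<in>T. 1 - f (fst x) j) \<le> (\<Prod>x\<in>S. 1 - f (fst x) j)" .
  then show ?thesis
    using max_coverage_mono[OF assms(1) g, of f j] le \<theta>
    unfolding joint_coverage_def case_prod_beta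
    by (intro add_mono mult_left_mono) auto
qed

lemma objective_relocate:
  assumes fin: "finite I" and sub: "S \<subseteq> facilities I K"
    and w: "\<And>j. j \<in> J \<Longrightarrow> w j \<ge> 0" and \<theta>: "\<theta> \<in> {0..1}"
    and le: "\<And>l j. l \<in> I \<Longrightarrow> j \<in> J \<Longrightarrow> f l j \<le> f (r l) j"
    and le1: "\<And>l j. l \<in> I \<Longrightarrow> j \<in> J \<Longrightarrow> f (r l) j \<le> 1"
  shows "objective J f w \<theta> S \<le> objective J f w \<theta> (relocate r S)"
proof -
  have finS: "finite S"
    using sub fin by (auto simp: facilities_def intro: finite_subset)
  have fstI: "fst x \<in> I" if "x \<in> S" for x
    using that sub by (auto simp: facilities_def)
  obtain g where g: "bij_betw g S (relocate r S)" "\<And>x. x \<in> S \<Longrightarrow> fst (g x) = r (fst x)"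
    using relocate_bij[OF finS] by metis
  show ?thesis
    unfolding objective_def
    by (intro sum_mono mult_left_mono joint_coverage_mono[OF finS g(1) \<theta>])
      (auto simp: g(2) fstI le le1 w)
qed

lemma optimal_exists:
  assumes "finite I"
  shows "\<exists>S. optimal I J f w \<theta> K S"
proof -
  let ?F = "{S. feasible I K S}"
  have "?F \<subseteq> Pow (facilities I K)" by (auto simp: feasible_def)
  then have fin: "finite ?F"
    using assms by (auto simp: facilities_def intro: finite_subset)
  have "{} \<in> ?F" by (simp add: feasible_def)
  then have "Max (objective J f w \<theta> ` ?F) \<in> objective J f w \<theta> ` ?F"
    using fin by (intro Max_in) auto
  then obtain S where S: "S \<in> ?F" "objective J f w \<theta> S = Max (objective J f w \<theta> ` ?F)"
    by auto
  then have "objective J f w \<theta> T \<le> objective J f w \<theta> S" if "feasible I K T" for T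
    using that fin by auto
  then show ?thesis using S(1) by (auto simp: optimal_def)
qed

theorem theorem3:
  fixes I :: "'i set" and J :: "'j set"
    and f :: "'i \<Rightarrow> 'j \<Rightarrow> real" and w :: "'j \<Rightarrow> real"
    and \<theta> :: real and K :: nat and i i' :: 'i
  assumes "finite I" and "I \<noteq> {}" and "finite J"
    and "\<And>l j. l \<in> I \<Longrightarrow> j \<in> J \<Longrightarrow> f l j \<in> {0..1}"
    and "\<And>j. j \<in> J \<Longrightarrow> w j \<ge> 0"
    and "\<theta> \<in> {0..1}"
    and "K \<ge> 1"
    and "i \<in> I" and "i' \<in> I" and "i \<noteq> i'"
    and "\<And>j. j \<in> J \<Longrightarrow> f i j \<ge> f i' j"
  shows "\<exists>S. optimal I J f w \<theta> K S \<and> ordered I K S \<and> unopened K i' S"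
proof -
  let ?r = "\<lambda>l. if l = i' then i else l"
  obtain S where S: "optimal I J f w \<theta> K S"
    using optimal_exists[OF assms(1)] by blast
  then have feas: "feasible I K S" by (simp add: optimal_def)
  have "objective J f w \<theta> S \<le> objective J f w \<theta> (relocate ?r S)"
  proof (rule objective_relocate[OF assms(1)])
    show "S \<subseteq> facilities I K" using feas by (simp add: feasible_def)
  qed (use assms in auto)
  moreover have "feasible I K (relocate ?r S)"
    using feasible_relocate[OF assms(1) feas] assms(8) by simp
  ultimately have "optimal I J f w \<theta> K (relocate ?r S)"
    using S by (fastforce simp: optimal_def)
  moreover have "unopened K i' (relocate ?r S)"
    using assms(10) by (intro unopened_relocate) auto
  ultimately show ?thesis
    using ordered_relocate by blast
qed

end
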